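(* For each integer $k\geq 2$ there is $M>0$ such that for any $k$ distinct $b_1,\dots,b_k\in\mathbb{Z}[i]$ with $N(b_j)\geq M$ for all $j$, there are infinitely many $z\in\mathbb{Z}[i]$ such that for every $j$, $z$ misses the digit zero in base $b_j$, i.e. $z=\sum_{l=0}^{m_j}r_lb_j^l$ for some $m_j\ge0$ and $r_l\in D_{b_j}\setminus\{0\}$.
   Context: For $b\in\mathbb{Z}[i]$, $N(b)=|b|^2$. The digit set $D_b$ is the set of Gaussian integers in the half-open square $\{sb+t\,ib: s,t\in[0,1)\}$, a fundamental domain of the lattice $b\mathbb{Z}[i]$; it has $N(b)$ elements and contains $0$. *)

theory Defs
  imports Complex_Main
begin

definition gauss_ints :: "complex set" where
  "gauss_ints = {z. Re z \<in> \<int> \<and> Im z \<in> \<int>}"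

definition gnorm :: "complex \<Rightarrow> real" where
  "gnorm b = (cmod b)\<^sup>2"

definition digit_set :: "complex \<Rightarrow> complex set" where
  "digit_set b = {d \<in> gauss_ints. \<exists>s\<in>{0..<1::real}. \<exists>t\<in>{0..<1::real}.
      d = of_real s * b + of_real t * (\<i> * b)}"

definition misses_zero_digit :: "complex \<Rightarrow> complex \<Rightarrow> bool" where
  "misses_zero_digit b z \<longleftrightarrow> (\<exists>(m::nat) (r :: nat \<Rightarrow> complex).
      (\<forall>l\<le>m. r l \<in> digit_set b - {0}) \<and> z = (\<Sum>l\<le>m. r l * b ^ l))"

end

theory Submission
  imports Defs "HOL-Analysis.Topology_Euclidean_Space"
begin

text \<open>
  Digit \<open>l\<close> of \<open>z\<close> in base \<open>b\<close> can vanish only if \<open>z\<close> lies within \<open>3 |b|^l\<close> of the lattice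
  \<open>b^(l+1) \<int>[\<i>]\<close>. For large \<open>|b|\<close> these discs are small compared with their distances, so they
  can all be avoided, for all bases and digit positions at once, by repeatedly passing from a box to
  a sub-box of smaller potential. The box to start from comes from exponents for which all the
  powers \<open>b j ^ m j\<close> are close to one real number \<open>X\<close>: near \<open>X (1 + \<i>) / 2\<close> the expansion in base
  \<open>b j\<close> stops after exactly \<open>m j\<close> digits. As \<open>X\<close> can be chosen arbitrarily large, this gives
  infinitely many \<open>z\<close>.
\<close>

section \<open>Digit expansions\<close>

lemma gauss_ints_add: "x \<in> gauss_ints \<Longrightarrow> y \<in> gauss_ints \<Longrightarrow> x + y \<in> gauss_ints"
  and gauss_ints_diff: "x \<in> gauss_ints \<Longrightarrow> y \<in> gauss_ints \<Longrightarrow> x - y \<in> gauss_ints"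
  and gauss_ints_mult: "x \<in> gauss_ints \<Longrightarrow> y \<in> gauss_ints \<Longrightarrow> x * y \<in> gauss_ints"
  by (auto simp: gauss_ints_def)

lemma gauss_ints_power: "x \<in> gauss_ints \<Longrightarrow> x ^ n \<in> gauss_ints"
  by (induction n) (auto simp: gauss_ints_mult gauss_ints_def)

lemma gauss_ints_sum: "(\<And>i. i \<in> A \<Longrightarrow> f i \<in> gauss_ints) \<Longrightarrow> sum f A \<in> gauss_ints"
  by (induction A rule: infinite_finite_induct) (auto simp: gauss_ints_add, auto simp: gauss_ints_def)

lemma gauss_ints_norm_ge_1:
  assumes "w \<in> gauss_ints" "w \<noteq> 0"
  shows "1 \<le> cmod w"
proof -
  have "Re w \<noteq> 0 \<or> Im w \<noteq> 0"
    using assms(2) by (simp add: complex_eq_iff)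
  then have "1 \<le> \<bar>Re w\<bar> \<or> 1 \<le> \<bar>Im w\<bar>"
    using assms(1) Ints_nonzero_abs_ge1 unfolding gauss_ints_def by blast
  then show ?thesis
    using abs_Re_le_cmod[of w] abs_Im_le_cmod[of w] by linarith
qed

section \<open>Digits, division and partial expansions\<close>

lemma digit_setE:
  assumes "d \<in> digit_set b"
  obtains s t :: real where "0 \<le> s" "s < 1" "0 \<le> t" "t < 1" "d = b * Complex s t"
  using assms unfolding digit_set_def by (auto simp: Complex_eq algebra_simps)

lemma digit_set_norm_le:
  assumes "d \<in> digit_set b"
  shows "cmod d \<le> 2 * cmod b"
proof -
  obtain s t :: real where st: "0 \<le> s" "s < 1" "0 \<le> t" "t < 1" "d = b * Complex s t"
    using assms by (rule digit_setE)
  have "cmod (Complex s t) \<le> 2"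
    using cmod_le[of "Complex s t"] st by simp
  then show ?thesis
    unfolding st(5) norm_mult using mult_left_mono[of "cmod (Complex s t)" 2 "cmod b"] by simp
qed

text \<open>Rounding both coordinates of \<open>z / b\<close> down gives the quotient; the
  fractional parts are the coordinates of the remainder in the half-open square.\<close>

lemma gauss_ints_division:
  assumes "b \<in> gauss_ints" "b \<noteq> 0" "z \<in> gauss_ints"
  obtains d q where "d \<in> digit_set b" "q \<in> gauss_ints" "z = d + b * q"
proof -
  define q where "q = Complex (of_int \<lfloor>Re (z / b)\<rfloor>) (of_int \<lfloor>Im (z / b)\<rfloor>)"
  have q: "q \<in> gauss_ints"
    by (simp add: q_def gauss_ints_def)
  have "z / b - q = Complex (frac (Re (z / b))) (frac (Im (z / b)))"
    by (simp add: q_def frac_def complex_eq_iff)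
  then have "z - b * q = b * Complex (frac (Re (z / b))) (frac (Im (z / b)))"
    using assms(2) by (simp add: field_simps)
  then have "z - b * q = of_real (frac (Re (z / b))) * b + of_real (frac (Im (z / b))) * (\<i> * b)"
    by (simp add: Complex_eq algebra_simps)
  moreover have "z - b * q \<in> gauss_ints"
    using assms q by (simp add: gauss_ints_diff gauss_ints_mult)
  moreover have "frac (Re (z / b)) \<in> {0..<1}" "frac (Im (z / b)) \<in> {0..<1}"
    by (simp_all add: frac_lt_1)
  ultimately have "z - b * q \<in> digit_set b"
    unfolding digit_set_def by blast
  then show ?thesis
    using q that[of "z - b * q" q] by simp
qed

text \<open>Iterated division with remainder. The last quotient \<open>w\<close> is kept: whether it
  vanishes depends on the size of \<open>z\<close> and is decided in
  \<open>misses_zero_digitI\<close>.\<close>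

lemma digit_expansion:
  assumes "b \<in> gauss_ints" "b \<noteq> 0" "z \<in> gauss_ints"
  shows "\<exists>r w. (\<forall>l<n. r l \<in> digit_set b) \<and> w \<in> gauss_ints \<and> z = (\<Sum>l<n. r l * b ^ l) + b ^ n * w"
proof (induction n)
  case 0
  then show ?case using assms by auto
next
  case (Suc n)
  then obtain r w where r: "\<forall>l<n. r l \<in> digit_set b" "w \<in> gauss_ints"
    "z = (\<Sum>l<n. r l * b ^ l) + b ^ n * w" by blast
  obtain d q where d: "d \<in> digit_set b" "q \<in> gauss_ints" "w = d + b * q"
    using gauss_ints_division assms(1,2) r(2) by blast
  have "(\<Sum>l<n. (r(n := d)) l * b ^ l) = (\<Sum>l<n. r l * b ^ l)"
    by (intro sum.cong) auto
  then have "z = (\<Sum>l<Suc n. (r(n := d)) l * b ^ l) + b ^ Suc n * q"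
    unfolding r(3) d(3) by (simp add: algebra_simps)
  then show ?case
    using r(1) d(1,2) by (intro exI[of _ "r(n := d)"] exI[of _ q]) (auto simp: less_Suc_eq)
qed

text \<open>The constant 3 reproduces itself: \<open>3 * cmod b ^ n\<close> is at most
  \<open>cmod b ^ Suc n\<close>, and the next digit adds at most
  \<open>2 * cmod b ^ Suc n\<close>.\<close>

lemma digit_sum_norm_le:
  assumes "3 \<le> cmod b" "\<forall>l<n. r l \<in> digit_set b"
  shows "cmod (\<Sum>l<n. r l * b ^ l) \<le> 3 * cmod b ^ n"
  using assms(2)
proof (induction n)
  case (Suc n)
  have "cmod (\<Sum>l<Suc n. r l * b ^ l) \<le> cmod (\<Sum>l<n. r l * b ^ l) + cmod (r n) * cmod b ^ n"
    using norm_triangle_ineq[of "\<Sum>l<n. r l * b ^ l" "r n * b ^ n"] by (simp add: norm_mult norm_power)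
  also have "\<dots> \<le> 3 * cmod b ^ n + 2 * cmod b * cmod b ^ n"
    using Suc digit_set_norm_le[of "r n" b] by (intro add_mono mult_right_mono) auto
  also have "\<dots> \<le> cmod b * cmod b ^ n + 2 * cmod b * cmod b ^ n"
    using assms(1) by (intro add_right_mono mult_right_mono) auto
  finally show ?case by simp
qed simp

text \<open>
  The centre condition makes the expansion stop after \<open>m\<close> digits. If digit \<open>l\<close> vanishes, then
  the lower digits place \<open>z\<close> within \<open>3 |b|^l\<close> of the lattice generated by \<open>b^(l+1)\<close>.
\<close>
lemma misses_zero_digitI:
  assumes b: "b \<in> gauss_ints" "100 \<le> cmod b" and z: "z \<in> gauss_ints" and "0 < m"
    and centre: "cmod (z - Complex (1/2) (1/2) * b ^ m) \<le> cmod b ^ m / 4"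
    and far: "\<And>l w. l < m \<Longrightarrow> w \<in> gauss_ints \<Longrightarrow> 3 * cmod b ^ l < cmod (z - b ^ Suc l * w)"
  shows "misses_zero_digit b z"
proof -
  have b0: "b \<noteq> 0" using b(2) by auto
  obtain r w where r: "\<forall>l<m. r l \<in> digit_set b" and w: "w \<in> gauss_ints"
    and z_eq: "z = (\<Sum>l<m. r l * b ^ l) + b ^ m * w"
    using digit_expansion[OF b(1) b0 z] by blast
  \<comment> \<open>Applying \<open>digit_sum_norm_le\<close> to all \<open>m\<close> digits would
    lose too much. The top digit is kept as a point of the unit square scaled by
    \<open>b ^ m\<close>, at most sqrt(1/2) < 71/100 from the centre. As 1/4 + 3/100 + 71/100 < 1,
    this forces \<open>w = 0\<close>.\<close>
  obtain n where n: "m = Suc n" using \<open>0 < m\<close> gr0_conv_Suc by auto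
  have "r n \<in> digit_set b" using r n by simp
  then obtain s t :: real where st: "0 \<le> s" "s < 1" "0 \<le> t" "t < 1" "r n = b * Complex s t"
    by (rule digit_setE)
  define S where "S = (\<Sum>l<n. r l * b ^ l)"
  have S: "cmod S \<le> 3 * cmod b ^ n"
    unfolding S_def using r n b by (intro digit_sum_norm_le) auto
  have Sm: "cmod S \<le> cmod b ^ m * (3 / 100)"
  proof -
    have "100 * cmod b ^ n \<le> cmod b ^ m"
      unfolding n using b(2) by (simp add: mult_right_mono)
    with S show ?thesis by simp
  qed
  have "z = b ^ m * Complex s t + S + b ^ m * w"
    unfolding z_eq n S_def by (simp add: st(5) algebra_simps)
  then have "b ^ m * w = (z - Complex (1/2) (1/2) * b ^ m) - S + b ^ m * (Complex (1/2) (1/2) - Complex s t)"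
    by (simp add: algebra_simps)
  then have "cmod (b ^ m * w) \<le> cmod (z - Complex (1/2) (1/2) * b ^ m) + cmod S
      + cmod (b ^ m * (Complex (1/2) (1/2) - Complex s t))"
    by (smt (verit) norm_triangle_ineq norm_triangle_ineq4)
  also have "\<dots> \<le> cmod b ^ m / 4 + cmod b ^ m * (3 / 100) + cmod b ^ m * (71/100)"
  proof (intro add_mono centre Sm)
    have sq: "(1/2 - e)\<^sup>2 \<le> 1/4" if "0 \<le> e" "e < 1" for e :: real
    proof -
      have "\<bar>1/2 - e\<bar> \<le> \<bar>1/2\<bar>" using that by linarith
      then show ?thesis
        unfolding abs_le_square_iff by (simp add: power2_eq_square)
    qed
    have *: "(1/2 - s)\<^sup>2 \<le> 1/4" "(1/2 - t)\<^sup>2 \<le> 1/4"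
      using st sq by blast+
    have "cmod (Complex (1/2) (1/2) - Complex s t) \<le> 71/100"
      unfolding cmod_def using * by (intro real_le_lsqrt) (auto simp: power2_eq_square)
    then show "cmod (b ^ m * (Complex (1/2) (1/2) - Complex s t)) \<le> cmod b ^ m * (71/100)"
      unfolding norm_mult norm_power by (intro mult_left_mono) auto
  qed
  also have "\<dots> < cmod b ^ m"
    using b0 by simp
  finally have "cmod w < 1"
    using b0 by (simp add: norm_mult norm_power)
  then have "w = 0" using gauss_ints_norm_ge_1[OF w] by linarith
  then have z_sum: "z = (\<Sum>l<m. r l * b ^ l)" using z_eq by simp
  have "r l \<noteq> 0" if l: "l < m" for l
  proof
    assume "r l = 0"
    have "z = (\<Sum>i<Suc l. r i * b ^ i) + (\<Sum>i\<in>{Suc l..<m}. r i * b ^ i)"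
      unfolding z_sum lessThan_atLeast0 using l by (intro sum.atLeastLessThan_concat[symmetric]) auto
    also have "(\<Sum>i\<in>{Suc l..<m}. r i * b ^ i) = b ^ Suc l * (\<Sum>i\<in>{Suc l..<m}. r i * b ^ (i - Suc l))"
      unfolding sum_distrib_left
    proof (intro sum.cong refl)
      fix i assume "i \<in> {Suc l..<m}"
      then have "b ^ i = b ^ Suc l * b ^ (i - Suc l)"
        by (metis atLeastLessThan_iff le_add_diff_inverse power_add)
      then show "r i * b ^ i = b ^ Suc l * (r i * b ^ (i - Suc l))" by simp
    qed
    finally have "z - b ^ Suc l * (\<Sum>i\<in>{Suc l..<m}. r i * b ^ (i - Suc l)) = (\<Sum>i<l. r i * b ^ i)"
      using \<open>r l = 0\<close> by simp
    moreover have "cmod (\<Sum>i<l. r i * b ^ i) \<le> 3 * cmod b ^ l"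
      using r l b by (intro digit_sum_norm_le) auto
    moreover have "(\<Sum>i\<in>{Suc l..<m}. r i * b ^ (i - Suc l)) \<in> gauss_ints"
      using r b by (intro gauss_ints_sum gauss_ints_mult gauss_ints_power) (auto simp: digit_set_def)
    ultimately show False using far[OF l] by force
  qed
  \<comment> \<open>The definition includes its upper index, so the witness is the top position
    \<open>n\<close>, not \<open>m\<close>.\<close>
  then show ?thesis
    unfolding misses_zero_digit_def using r z_sum n
    by (intro exI[of _ n] exI[of _ r]) (auto simp: lessThan_Suc_atMost)
qed

section \<open>Avoiding sparse bad sets\<close>

text \<open>A box of level \<open>Suc n\<close> splits exactly into 400 boxes of level
  \<open>n\<close>; a box of level 0 is a single point.\<close>

definition int_box :: "nat \<Rightarrow> int \<Rightarrow> int \<Rightarrow> (int \<times> int) set" where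
  "int_box n x y = {x..<x + 20 ^ n} \<times> {y..<y + 20 ^ n}"

lemma int_subbox_subset:
  assumes "a \<in> {0..<20}" "c \<in> {0..<20}"
  shows "int_box n (x + a * 20 ^ n) (y + c * 20 ^ n) \<subseteq> int_box (Suc n) x y"
proof -
  have "0 \<le> e * 20 ^ n \<and> e * 20 ^ n \<le> 19 * 20 ^ n" if "e \<in> {0..<20}" for e :: int
    using that by (intro conjI mult_nonneg_nonneg mult_right_mono) auto
  from this[OF assms(1)] this[OF assms(2)] show ?thesis
    unfolding int_box_def power_Suc
    by (intro Sigma_mono subsetI) (unfold atLeastLessThan_iff, linarith+)
qed

lemma card_le_3_of_diff_le_2:
  fixes A :: "int set"
  assumes "finite A" "\<And>a c. a \<in> A \<Longrightarrow> c \<in> A \<Longrightarrow> \<bar>a - c\<bar> \<le> 2"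
  shows "card A \<le> 3"
proof (cases "A = {}")
  case False
  have "A \<subseteq> {Min A..Min A + 2}"
  proof
    fix a assume "a \<in> A"
    then show "a \<in> {Min A..Min A + 2}"
      using assms(2)[of a "Min A"] Min_in[OF assms(1) False] Min_le[OF assms(1)] by fastforce
  qed
  then have "card A \<le> card {Min A..Min A + 2}"
    by (intro card_mono) auto
  then show ?thesis by simp
qed simp

text \<open>Points of \<open>B\<close> in the large box differ by less than
  \<open>2 * 20 ^ n\<close> per coordinate, so the indices of two hit sub-boxes differ by less than
  3. Hits thus occupy at most 3 rows and 3 columns.\<close>

lemma card_hit_subboxes_le:
  fixes B :: "(int \<times> int) set" and \<rho> :: real
  assumes "\<rho> < 20 ^ n"
    and close: "\<And>p q. p \<in> B \<inter> int_box (Suc n) x y \<Longrightarrow> q \<in> B \<inter> int_box (Suc n) x y \<Longrightarrow>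
      real_of_int \<bar>fst p - fst q\<bar> \<le> 2 * \<rho> \<and> real_of_int \<bar>snd p - snd q\<bar> \<le> 2 * \<rho>"
  shows "card {(a, c) \<in> {0..<20} \<times> {0..<20}. B \<inter> int_box n (x + a * 20 ^ n) (y + c * 20 ^ n) \<noteq> {}} \<le> 9"
    (is "card ?H \<le> 9")
proof -
  have fin: "finite ?H"
    by (rule finite_subset[of _ "{0..<20} \<times> {0..<20}"]) auto
  have key: "\<bar>a - a'\<bar> \<le> 2" if "x + a * 20 ^ n \<le> u" "u < x + a * 20 ^ n + 20 ^ n"
    "x + a' * 20 ^ n \<le> u'" "u' < x + a' * 20 ^ n + 20 ^ n" "real_of_int \<bar>u - u'\<bar> \<le> 2 * \<rho>" for a a' u u' x :: int
  proof -
    have "real_of_int \<bar>u - u'\<bar> < real_of_int (2 * 20 ^ n)" using that(5) assms(1) by simp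
    then have "\<bar>u - u'\<bar> < 2 * 20 ^ n" by linarith
    then have "(a - a') * 20 ^ n < 3 * 20 ^ n" "(a' - a) * 20 ^ n < 3 * 20 ^ n"
      using that by (auto simp: left_diff_distrib)
    then show ?thesis by simp
  qed
  have diff: "\<bar>a - a'\<bar> \<le> 2 \<and> \<bar>c - c'\<bar> \<le> 2" if h: "(a, c) \<in> ?H" "(a', c') \<in> ?H" for a a' c c'
  proof -
    have "int_box n (x + a * 20 ^ n) (y + c * 20 ^ n) \<subseteq> int_box (Suc n) x y"
      "int_box n (x + a' * 20 ^ n) (y + c' * 20 ^ n) \<subseteq> int_box (Suc n) x y"
      using h by (intro int_subbox_subset; simp)+
    moreover obtain p where "p \<in> B" "p \<in> int_box n (x + a * 20 ^ n) (y + c * 20 ^ n)"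
      using h(1) by blast
    moreover obtain q where "q \<in> B" "q \<in> int_box n (x + a' * 20 ^ n) (y + c' * 20 ^ n)"
      using h(2) by blast
    ultimately have "real_of_int \<bar>fst p - fst q\<bar> \<le> 2 * \<rho>" "real_of_int \<bar>snd p - snd q\<bar> \<le> 2 * \<rho>"
      using close[of p q] by (meson IntI subsetD)+
    moreover note \<open>p \<in> int_box _ _ _\<close> \<open>q \<in> int_box _ _ _\<close>
    ultimately show ?thesis
      using key[of x a "fst p" a' "fst q"] key[of y c "snd p" c' "snd q"]
      by (simp add: int_box_def mem_Times_iff)
  qed
  have rows: "card (f ` ?H) \<le> 3"
    if "\<And>v w. v \<in> ?H \<Longrightarrow> w \<in> ?H \<Longrightarrow> \<bar>f v - f w\<bar> \<le> 2" for f :: "int \<times> int \<Rightarrow> int"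
  proof (rule card_le_3_of_diff_le_2)
    show "finite (f ` ?H)" using fin by (rule finite_imageI)
    show "\<bar>a - c\<bar> \<le> 2" if "a \<in> f ` ?H" "c \<in> f ` ?H" for a c
      using that \<open>\<And>v w. v \<in> ?H \<Longrightarrow> w \<in> ?H \<Longrightarrow> \<bar>f v - f w\<bar> \<le> 2\<close> by (elim imageE) (simp only:)
  qed
  have "\<bar>fst v - fst w\<bar> \<le> 2 \<and> \<bar>snd v - snd w\<bar> \<le> 2" if "v \<in> ?H" "w \<in> ?H" for v w
    using diff[of "fst v" "snd v" "fst w" "snd w"] that unfolding prod.collapse by blast
  then have "card (fst ` ?H) \<le> 3" "card (snd ` ?H) \<le> 3"
    by (blast intro: rows)+
  then have "card (fst ` ?H \<times> snd ` ?H) \<le> 3 * 3"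
    unfolding card_cartesian_product by (rule mult_le_mono)
  moreover have "card ?H \<le> card (fst ` ?H \<times> snd ` ?H)"
    using fin by (intro card_mono finite_cartesian_product finite_imageI subset_fst_snd)
  ultimately show ?thesis by linarith
qed

text \<open>
  The sum below is a potential: a bad set \<open>i\<close> counts with weight \<open>\<rho> i\<close> only while it meets the box,
  and only once the box has side at most \<open>20 ^ lev i\<close>. A set of diameter \<open>2 * \<rho> i\<close> meets at most
  9 of the 400 sub-boxes, so some sub-box carries at most \<open>9/400\<close> of the potential, whereas the
  side shrinks only by \<open>1/20\<close>; this gain pays for the sets that are counted for the first time.
\<close>
lemma box_avoids_bad_sets:
  fixes Bad :: "'i \<Rightarrow> (int \<times> int) set" and \<rho> :: "'i \<Rightarrow> real" and lev :: "'i \<Rightarrow> nat"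
  assumes fin: "finite I" and \<rho>: "\<And>i. i \<in> I \<Longrightarrow> 1 \<le> \<rho> i"
    and close: "\<And>i p q. i \<in> I \<Longrightarrow> p \<in> Bad i \<Longrightarrow> q \<in> Bad i \<Longrightarrow>
      \<bar>fst p - fst q\<bar> \<le> 20 ^ lev i \<Longrightarrow> \<bar>snd p - snd q\<bar> \<le> 20 ^ lev i \<Longrightarrow>
      real_of_int \<bar>fst p - fst q\<bar> \<le> 2 * \<rho> i \<and> real_of_int \<bar>snd p - snd q\<bar> \<le> 2 * \<rho> i"
    and new: "\<And>n. (\<Sum>i | i \<in> I \<and> lev i = n. \<rho> i) \<le> 20 ^ n / 50"
    and potential: "(\<Sum>i | i \<in> I \<and> n \<le> lev i \<and> Bad i \<inter> int_box n x y \<noteq> {}. \<rho> i) \<le> 20 ^ n / 25"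
  shows "\<exists>p\<in>int_box n x y. \<forall>i\<in>I. p \<notin> Bad i"
  using potential
proof (induction n arbitrary: x y)
  case 0
  \<comment> \<open>A bad set meeting the one-point box would contribute at least 1 to a potential
    of at most 1/25.\<close>
  have "Bad i \<inter> int_box 0 x y = {}" if "i \<in> I" for i
  proof (rule ccontr)
    assume "Bad i \<inter> int_box 0 x y \<noteq> {}"
    then have "\<rho> i \<le> (\<Sum>i | i \<in> I \<and> 0 \<le> lev i \<and> Bad i \<inter> int_box 0 x y \<noteq> {}. \<rho> i)"
      using that fin \<rho> by (intro member_le_sum) (auto intro: order.trans[of 0 1])
    then show False using 0 \<rho>[OF that] by simp
  qed
  moreover have "(x, y) \<in> int_box 0 x y" by (simp add: int_box_def)
  ultimately show ?case by blast
next
  case (Suc n)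
  define S where "S = {i \<in> I. Suc n \<le> lev i \<and> Bad i \<inter> int_box (Suc n) x y \<noteq> {}}"
  define K :: "(int \<times> int) set" where "K = {0..<20} \<times> {0..<20}"
  define sub where "sub = (\<lambda>(a, c). int_box n (x + a * 20 ^ n) (y + c * 20 ^ n))"
  have finS: "finite S" using fin by (simp add: S_def)
  have finK: "finite K" and cardK: "card K = 400" by (simp_all add: K_def)
  have sub: "sub v \<subseteq> int_box (Suc n) x y" if "v \<in> K" for v
    using that int_subbox_subset unfolding sub_def K_def case_prod_unfold by (intro int_subbox_subset) auto
  have pot: "sum \<rho> S \<le> 20 ^ Suc n / 25"
    using Suc.prems unfolding S_def by simp
  have pos: "0 \<le> \<rho> i" if "i \<in> I" for i using \<rho>[OF that] by simp
  have hits: "card {v \<in> K. Bad i \<inter> sub v \<noteq> {}} \<le> 9" if "i \<in> S" for i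
  proof -
    have iI: "i \<in> I" and lev: "Suc n \<le> lev i" using that by (auto simp: S_def)
    \<comment> \<open>The potential also bounds each single weight: \<open>20 ^ Suc n / 25\<close>
      is 4/5 of the side of a sub-box.\<close>
    have "\<rho> i \<le> sum \<rho> S"
      using that finS pos by (intro member_le_sum) (auto simp: S_def)
    also note pot
    also have "(20::real) ^ Suc n / 25 < 20 ^ n" by simp
    finally have "\<rho> i < 20 ^ n" .
    moreover have "real_of_int \<bar>fst p - fst q\<bar> \<le> 2 * \<rho> i \<and> real_of_int \<bar>snd p - snd q\<bar> \<le> 2 * \<rho> i"
      if "p \<in> Bad i \<inter> int_box (Suc n) x y" "q \<in> Bad i \<inter> int_box (Suc n) x y" for p q
    proof -
      have "(20::int) ^ Suc n \<le> 20 ^ lev i" using lev by (intro power_increasing) auto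
      then have "\<bar>fst p - fst q\<bar> \<le> 20 ^ lev i" "\<bar>snd p - snd q\<bar> \<le> 20 ^ lev i"
        using that unfolding int_box_def by auto
      then show ?thesis using close[OF iI] that by blast
    qed
    ultimately have "card {(a, c) \<in> {0..<20} \<times> {0..<20}.
        Bad i \<inter> int_box n (x + a * 20 ^ n) (y + c * 20 ^ n) \<noteq> {}} \<le> 9"
      by (rule card_hit_subboxes_le)
    moreover have "{(a, c) \<in> {0..<20} \<times> {0..<20}.
        Bad i \<inter> int_box n (x + a * 20 ^ n) (y + c * 20 ^ n) \<noteq> {}} = {v \<in> K. Bad i \<inter> sub v \<noteq> {}}"
      by (auto simp: K_def sub_def)
    ultimately show ?thesis by simp
  qed
  \<comment> \<open>Averaging: otherwise the 400 sub-boxes would carry at least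
    \<open>8 * 20 ^ n\<close> in total, but each bad set is counted at most 9 times, which gives at
    most 7.2 times \<open>20 ^ n\<close>.\<close>
  have "\<exists>v\<in>K. (\<Sum>i | i \<in> S \<and> Bad i \<inter> sub v \<noteq> {}. \<rho> i) \<le> 20 ^ n / 50"
  proof (rule ccontr)
    assume "\<not> ?thesis"
    then have "of_nat (card K) * (20 ^ n / 50) \<le> (\<Sum>v\<in>K. \<Sum>i | i \<in> S \<and> Bad i \<inter> sub v \<noteq> {}. \<rho> i)"
      by (intro sum_bounded_below) force
    also have "\<dots> = (\<Sum>i\<in>S. \<Sum>v | v \<in> K \<and> Bad i \<inter> sub v \<noteq> {}. \<rho> i)"
      using finK finS by (rule sum.swap_restrict)
    also have "\<dots> \<le> (\<Sum>i\<in>S. 9 * \<rho> i)"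
    proof (rule sum_mono)
      fix i assume "i \<in> S"
      then show "(\<Sum>v | v \<in> K \<and> Bad i \<inter> sub v \<noteq> {}. \<rho> i) \<le> 9 * \<rho> i"
        using hits[of i] pos[of i] by (auto simp: S_def intro!: mult_right_mono)
    qed
    also have "\<dots> \<le> 9 * (20 ^ Suc n / 25)"
      using pot by (simp add: sum_distrib_left[symmetric])
    finally show False by (simp add: cardK)
  qed
  then obtain a c where ac: "(a, c) \<in> K"
    and le: "(\<Sum>i | i \<in> S \<and> Bad i \<inter> sub (a, c) \<noteq> {}. \<rho> i) \<le> 20 ^ n / 50" by auto
  \<comment> \<open>The allowance \<open>20 ^ n / 25\<close> is split evenly between bad sets
    inherited from \<open>S\<close> and those of level exactly \<open>n\<close>.\<close>
  have "(\<Sum>i | i \<in> I \<and> n \<le> lev i \<and> Bad i \<inter> sub (a, c) \<noteq> {}. \<rho> i)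
      \<le> sum \<rho> ({i \<in> S. Bad i \<inter> sub (a, c) \<noteq> {}} \<union> {i \<in> I. lev i = n})"
    using fin pos sub[OF ac] by (intro sum_mono2) (auto simp: S_def)
  also have "\<dots> \<le> (\<Sum>i | i \<in> S \<and> Bad i \<inter> sub (a, c) \<noteq> {}. \<rho> i) + (\<Sum>i | i \<in> I \<and> lev i = n. \<rho> i)"
    using fin by (subst sum.union_disjoint) (auto simp: S_def)
  also have "\<dots> \<le> 20 ^ n / 25" using le new[of n] by simp
  finally have "\<exists>p\<in>sub (a, c). \<forall>i\<in>I. p \<notin> Bad i"
    using Suc.IH unfolding sub_def by simp
  then show ?case using sub[OF ac] by blast
qed

section \<open>Simultaneous powers\<close>

text \<open>Bolzano-Weierstrass for one index at a time; convergence already obtained survives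
  further thinning.\<close>

lemma simultaneous_convergent_subsequence:
  fixes u :: "'j \<Rightarrow> nat \<Rightarrow> complex"
  assumes "finite J" "\<And>j. j \<in> J \<Longrightarrow> bounded (range (u j))"
  shows "\<exists>r. strict_mono r \<and> (\<forall>j\<in>J. convergent (u j \<circ> r))"
  using assms
proof (induction J rule: finite_induct)
  case empty
  then show ?case using strict_mono_id by blast
next
  case (insert i J)
  then obtain r where r: "strict_mono r" "\<forall>j\<in>J. convergent (u j \<circ> r)" by blast
  have "bounded (range (u i \<circ> r))"
    using insert.prems[of i] bounded_subset[of "range (u i)" "range (u i \<circ> r)"] by auto
  then obtain l s where s: "strict_mono s" "((u i \<circ> r) \<circ> s) \<longlonglongrightarrow> l"
    using bounded_imp_convergent_subsequence by blast
  have "convergent (u j \<circ> (r \<circ> s))" if "j \<in> J" for j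
    using convergent_subseq_convergent[OF _ s(1), of "u j \<circ> r"] r(2) that by (simp add: o_assoc)
  moreover have "convergent (u i \<circ> (r \<circ> s))"
    using s(2) by (auto simp: convergent_def o_assoc)
  ultimately show ?case
    using strict_mono_o[OF r(1) s(1)] by blast
qed

lemma greatest_power_le:
  fixes c t :: real
  assumes "1 < c" "1 \<le> t"
  obtains n :: nat where "c ^ n \<le> t" "t < c ^ Suc n"
proof -
  obtain N where N: "t < c ^ N" using real_arch_pow[OF assms(1)] by blast
  have "(LEAST n. t < c ^ n) \<noteq> 0"
    using LeastI[of "\<lambda>n. t < c ^ n", OF N] assms(2) by (metis not_less power_0)
  then obtain n where n: "(LEAST n. t < c ^ n) = Suc n" using not0_implies_Suc by blast
  show ?thesis
  proof
    show "c ^ n \<le> t" using not_less_Least[of n "\<lambda>n. t < c ^ n"] n by simp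
    show "t < c ^ Suc n" using LeastI[of "\<lambda>n. t < c ^ n", OF N] n by simp
  qed
qed

text \<open>
  Let \<open>b j ^ f j n\<close> be the largest power of modulus at most \<open>2 ^ n\<close>. The quotients
  \<open>b j ^ f j n / 2 ^ n\<close> are bounded and bounded away from 0, so along a subsequence two of them
  are nearly equal, and dividing one by the other gives the claim.
\<close>
lemma simultaneous_powers_near_real:
  fixes b :: "'j \<Rightarrow> complex"
  assumes fin: "finite J" and b: "\<And>j. j \<in> J \<Longrightarrow> 1 < cmod (b j)"
  shows "\<exists>X m. N < X \<and> (\<forall>j\<in>J. cmod (b j ^ m j - of_real X) \<le> X / 100)"
proof -
  have "\<exists>f. \<forall>n. cmod (b j) ^ f n \<le> 2 ^ n \<and> 2 ^ n < cmod (b j) ^ Suc (f n)" if "j \<in> J" for j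
  proof (rule choice, rule allI)
    fix n
    show "\<exists>e. cmod (b j) ^ e \<le> 2 ^ n \<and> 2 ^ n < cmod (b j) ^ Suc e"
      using greatest_power_le[OF b[OF that], of "2 ^ n"] by (metis one_le_numeral one_le_power)
  qed
  then obtain f where f: "\<And>j n. j \<in> J \<Longrightarrow> cmod (b j) ^ f j n \<le> 2 ^ n"
    "\<And>j n. j \<in> J \<Longrightarrow> 2 ^ n < cmod (b j) ^ Suc (f j n)" by metis
  define u where "u j n = b j ^ f j n / 2 ^ n" for j n
  have u_le: "cmod (u j n) \<le> 1" if "j \<in> J" for j n
    using f(1)[OF that] by (simp add: u_def norm_divide norm_power)
  have u_ge: "1 / cmod (b j) \<le> cmod (u j n)" if "j \<in> J" for j n
    using f(2)[OF that, of n] b[OF that] by (simp add: u_def norm_divide norm_power divide_simps mult.commute)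
  obtain r where r: "strict_mono r" "\<forall>j\<in>J. convergent (u j \<circ> r)"
    using simultaneous_convergent_subsequence[OF fin, of u] u_le by (fastforce simp: bounded_iff)
  \<comment> \<open>As \<open>u j n\<close> has modulus at least \<open>1 / cmod (b j)\<close>, this
    tolerance amounts to a relative error of at most 1/100.\<close>
  have "\<forall>j\<in>J. \<exists>M. \<forall>n\<ge>M. \<forall>n'\<ge>M. dist ((u j \<circ> r) n) ((u j \<circ> r) n') < 1 / (100 * cmod (b j))"
  proof
    fix j assume j: "j \<in> J"
    have "Cauchy (u j \<circ> r)" using r(2) j convergent_Cauchy by blast
    moreover have "0 < 1 / (100 * cmod (b j))" using b[OF j] by (simp del: zero_less_norm_iff)
    ultimately show "\<exists>M. \<forall>n\<ge>M. \<forall>n'\<ge>M. dist ((u j \<circ> r) n) ((u j \<circ> r) n') < 1 / (100 * cmod (b j))"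
      unfolding Cauchy_def by blast
  qed
  then obtain M where M: "\<And>j n n'. j \<in> J \<Longrightarrow> M j \<le> n \<Longrightarrow> M j \<le> n' \<Longrightarrow>
    dist ((u j \<circ> r) n) ((u j \<circ> r) n') < 1 / (100 * cmod (b j))" by metis
  define n where "n = Max (insert 0 (M ` J))"
  have Mn: "M j \<le> n" if "j \<in> J" for j
    unfolding n_def using that fin by (intro Max_ge) auto
  \<comment> \<open>A gap of at least \<open>e\<close> between the two indices makes
    \<open>X = 2 ^ (q - p)\<close> exceed \<open>N\<close>.\<close>
  obtain e where e: "N < 2 ^ e" using real_arch_pow[of 2 N] by auto
  define p q where "p = r n" and "q = r (n + e)"
  have pq: "p + e \<le> q"
    unfolding p_def q_def by (induction e) (use r(1) in \<open>auto simp: strict_mono_Suc_iff Suc_le_eq intro: le_less_trans\<close>)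
  have "N < 2 ^ (q - p)"
    using e power_increasing[of e "q - p" "2::real"] pq by linarith
  moreover have "cmod (b j ^ (f j q - f j p) - of_real (2 ^ (q - p))) \<le> 2 ^ (q - p) / 100" if j: "j \<in> J" for j
  proof -
    have b1: "1 < cmod (b j)" using b[OF j] .
    \<comment> \<open>The exponents are ordered, so \<open>f j q - f j p\<close> is a genuine
      difference of naturals.\<close>
    have "cmod (b j) ^ f j p < cmod (b j) ^ Suc (f j q)"
      using f(1)[OF j, of p] f(2)[OF j, of q] power_increasing[of p q "2::real"] pq by linarith
    then have fpq: "f j p \<le> f j q"
      using power_less_imp_less_exp[OF b1] by fastforce
    have u0: "u j p \<noteq> 0" 
    proof
      assume "u j p = 0"
      then have "1 / cmod (b j) \<le> 0" using u_ge[OF j, of p] by simp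
      then show False using b1 by (simp add: divide_le_0_iff)
    qed
    have "cmod (u j q - u j p) \<le> 1 / (100 * cmod (b j))"
      using M[OF j Mn[OF j], of "n + e"] Mn[OF j] by (simp add: p_def q_def dist_norm norm_minus_commute)
    also have "\<dots> \<le> cmod (u j p) / 100" using u_ge[OF j, of p] by simp
    finally have "cmod ((u j q - u j p) / u j p) \<le> 1 / 100"
      using u0 by (simp add: norm_divide divide_le_eq)
    then have "cmod (u j q / u j p - 1) \<le> 1 / 100"
      using u0 by (simp add: diff_divide_distrib)
    moreover have "u j q / u j p = b j ^ (f j q - f j p) / 2 ^ (q - p)"
      unfolding u_def using fpq pq b1 by (subst (1 2) power_diff) (auto simp: field_simps)
    ultimately have "cmod (b j ^ (f j q - f j p) / 2 ^ (q - p) - 1) \<le> 1 / 100" by simp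
    moreover have "b j ^ (f j q - f j p) - of_real (2 ^ (q - p))
        = 2 ^ (q - p) * (b j ^ (f j q - f j p) / 2 ^ (q - p) - 1)"
      by (simp add: field_simps)
    ultimately show ?thesis
      by (simp only: norm_mult norm_power) simp
  qed
  ultimately show ?thesis by (intro exI[of _ "2 ^ (q - p)"] exI[of _ "\<lambda>j. f j q - f j p"]) blast
qed


section \<open>Common integers\<close>

lemma gauss_ints_of_int: "Complex (of_int u) (of_int v) \<in> gauss_ints"
  by (simp add: gauss_ints_def)

lemma cmod_le_abs_sum: "cmod (Complex u v) \<le> \<bar>u\<bar> + \<bar>v\<bar>"
  using cmod_le[of "Complex u v"] by simp

text \<open>Distinct points of the lattice are at least \<open>cmod b ^ Suc l\<close> apart. The two
  radii and the distance of \<open>p\<close> and \<open>q\<close> add up to less, so both points lie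
  in the same disc.\<close>

lemma near_lattice_points_close:
  assumes b: "b \<in> gauss_ints" "100 \<le> cmod b" and w: "w \<in> gauss_ints" "w' \<in> gauss_ints"
    and near: "cmod (p - b ^ Suc l * w) \<le> 3 * cmod b ^ l" "cmod (q - b ^ Suc l * w') \<le> 3 * cmod b ^ l"
    and pq: "cmod (p - q) \<le> cmod b ^ Suc l / 2"
  shows "cmod (p - q) \<le> 6 * cmod b ^ l"
proof -
  have pos: "0 < cmod b ^ Suc l" using b(2) by (intro zero_less_power) auto
  have "100 * cmod b ^ l \<le> cmod b ^ Suc l"
    using b(2) by (simp add: mult_right_mono)
  then have small: "6 * cmod b ^ l < cmod b ^ Suc l / 2" using pos by linarith
  have "b ^ Suc l * (w - w') = (p - q) - (p - b ^ Suc l * w) + (q - b ^ Suc l * w')"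
    by (simp add: algebra_simps)
  then have "cmod (b ^ Suc l * (w - w')) \<le> cmod (p - q) + cmod (p - b ^ Suc l * w) + cmod (q - b ^ Suc l * w')"
    by (smt (verit) norm_triangle_ineq norm_triangle_ineq4)
  also have "\<dots> < cmod b ^ Suc l" using near pq small by linarith
  finally have "cmod b ^ Suc l * cmod (w - w') < cmod b ^ Suc l * 1"
    by (simp only: norm_mult norm_power mult_1_right)
  then have "cmod (w - w') < 1" using pos by (simp only: mult_less_cancel_left_pos)
  then have "w = w'"
    using gauss_ints_norm_ge_1[OF gauss_ints_diff[OF w]] by fastforce
  have "p - q = (p - b ^ Suc l * w) - (q - b ^ Suc l * w)" by simp
  then have "cmod (p - q) \<le> cmod (p - b ^ Suc l * w) + cmod (q - b ^ Suc l * w)"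
    by (metis norm_triangle_ineq4)
  then show ?thesis using near \<open>w = w'\<close> by simp
qed

text \<open>The factor \<open>card J\<close> is there because each level receives up to one bad set
  per base, and their total weight must stay below \<open>20 ^ n / 50\<close>.\<close>

lemma exists_large_misses_zero_digit:
  fixes b :: "'j \<Rightarrow> complex"
  assumes fin: "finite J" and ne: "J \<noteq> {}"
    and b: "\<And>j. j \<in> J \<Longrightarrow> b j \<in> gauss_ints"
    and large: "\<And>j. j \<in> J \<Longrightarrow> 10 ^ 6 * real (card J) \<le> cmod (b j)"
  shows "\<exists>z\<in>gauss_ints. N < cmod z \<and> (\<forall>j\<in>J. misses_zero_digit (b j) z)"
proof -
  have card1: "1 \<le> real (card J)"
    using fin ne by (simp add: Suc_le_eq card_gt_0_iff)
  have b6: "10 ^ 6 \<le> cmod (b j)" if "j \<in> J" for j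
    using large[OF that] card1 by simp
  have b1: "1 < cmod (b j)" if "j \<in> J" for j
    using b6[OF that] by simp
  \<comment> \<open>\<open>4 * N\<close> suffices since the real part of the point found is at least
    \<open>3 * X / 8\<close>; 1000 excludes \<open>m j = 0\<close> and absorbs rounding.\<close>
  obtain X m where "max (4 * N) 1000 < X"
    and X: "\<And>j. j \<in> J \<Longrightarrow> cmod (b j ^ m j - of_real X) \<le> X / 100"
    using simultaneous_powers_near_real[of J b "max (4 * N) 1000"] fin b1 by blast
  then have XN: "4 * N < X" and X1000: "1000 < X" by auto
  have norm_bm: "99 / 100 * X \<le> cmod (b j) ^ m j" "cmod (b j) ^ m j \<le> 101 / 100 * X" if "j \<in> J" for j
  proof -
    have "\<bar>cmod (b j ^ m j) - cmod (of_real X)\<bar> \<le> X / 100"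
      using X[OF that] norm_triangle_ineq3 order_trans by blast
    then have "\<bar>cmod (b j) ^ m j - X\<bar> \<le> X / 100" using X1000 by (simp add: norm_power)
    then show "99 / 100 * X \<le> cmod (b j) ^ m j" "cmod (b j) ^ m j \<le> 101 / 100 * X" by linarith+
  qed
  have m_pos: "0 < m j" if "j \<in> J" for j
    using norm_bm(1)[OF that] X1000 by (cases "m j") auto

  \<comment> \<open>Bad sets, their weights and levels\<close>
  define I where "I = Sigma J (\<lambda>j. {..<m j})"
  define \<rho> where "\<rho> = (\<lambda>(j, l). 3 * cmod (b j) ^ l)"
  define pt :: "int \<times> int \<Rightarrow> complex" where "pt = (\<lambda>(u, v). Complex (of_int u) (of_int v))"
  define Bad where "Bad = (\<lambda>(j, l). {p. \<exists>w\<in>gauss_ints. cmod (pt p - b j ^ Suc l * w) \<le> 3 * cmod (b j) ^ l})"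
  \<comment> \<open>The level makes \<open>20 ^ lev\<close> smaller than the lattice spacing by a
    factor between 320 and 6400: small enough to isolate one disc, large enough to dominate its
    radius.\<close>
  have "\<exists>n. 16 * 20 ^ Suc n \<le> cmod (b j) ^ Suc l \<and> cmod (b j) ^ Suc l < 16 * 20 ^ Suc (Suc n)"
    if "j \<in> J" for j l
  proof -
    have "cmod (b j) * 1 \<le> cmod (b j) * cmod (b j) ^ l"
      using b1[OF that] by (intro mult_left_mono one_le_power) auto
    then have "1 \<le> cmod (b j) ^ Suc l / 320" using b6[OF that] by simp
    from greatest_power_le[OF _ this, of 20] show ?thesis
      by (force simp: field_simps)
  qed
  then obtain lv where lv: "\<And>j l. j \<in> J \<Longrightarrow> 16 * 20 ^ Suc (lv j l) \<le> cmod (b j) ^ Suc l"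
    "\<And>j l. j \<in> J \<Longrightarrow> cmod (b j) ^ Suc l < 16 * 20 ^ Suc (Suc (lv j l))" by metis
  define lev where "lev = (\<lambda>(j, l). lv j l)"
  have finI: "finite I" unfolding I_def using fin by auto

  \<comment> \<open>Raising \<open>l\<close> by one multiplies the spacing by at least
    \<open>10 ^ 6\<close>, while one level spans only a factor 20.\<close>
  have lv_inj: "l = l'" if "j \<in> J" "lv j l = lv j l'" for j l l'
  proof -
    have less: "lv j l \<noteq> lv j l'" if "l < l'" for l l'
    proof
      assume eq: "lv j l = lv j l'"
      have "cmod (b j) ^ Suc (Suc l) \<le> cmod (b j) ^ Suc l'"
        using b1[OF \<open>j \<in> J\<close>] \<open>l < l'\<close> by (intro power_increasing) auto
      moreover have "1000000 * cmod (b j) ^ Suc l \<le> cmod (b j) ^ Suc (Suc l)"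
        unfolding power_Suc[of _ "Suc l"] using b6[OF \<open>j \<in> J\<close>] by (intro mult_right_mono) auto
      ultimately have "1000000 * (16 * 20 ^ Suc (lv j l)) < (16 * 20 ^ Suc (Suc (lv j l)) :: real)"
        using lv(1)[OF \<open>j \<in> J\<close>, of l] lv(2)[OF \<open>j \<in> J\<close>, of l'] unfolding eq by linarith
      then show False by simp
    qed
    show ?thesis using less[of l l'] less[of l' l] that(2) by (metis linorder_neqE_nat)
  qed
  have new: "(\<Sum>i | i \<in> I \<and> lev i = n. \<rho> i) \<le> 20 ^ n / 50" for n
  proof -
    define T where "T = {i \<in> I. lev i = n}"
    have finT: "finite T" using finI by (simp add: T_def)
    have bound: "\<rho> i \<le> 20 ^ n / (50 * real (card J))" if "i \<in> T" for i
    proof -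
      obtain j l where i: "i = (j, l)" by (cases i)
      with that have j: "j \<in> J" and n: "lv j l = n" by (auto simp: T_def I_def lev_def)
      have "10 ^ 6 * real (card J) * cmod (b j) ^ l \<le> cmod (b j) ^ Suc l"
        unfolding power_Suc using large[OF j] by (intro mult_right_mono) auto
      also have "\<dots> \<le> 6400 * 20 ^ n" using lv(2)[OF j, of l] n by simp
      \<comment> \<open>The constant \<open>10 ^ 6\<close> is calibrated here: 150 times 6400 is
        960000.\<close>
      finally have "3 * cmod (b j) ^ l * (50 * real (card J)) \<le> 150 * 6400 * 20 ^ n / 10 ^ 6"
        by simp
      also have "\<dots> \<le> (20::real) ^ n" by simp
      finally show ?thesis
        using card1 by (simp add: i \<rho>_def pos_le_divide_eq)
    qed
    have "inj_on fst T"
      by (auto simp: inj_on_def T_def I_def lev_def intro: lv_inj)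
    moreover have "fst ` T \<subseteq> J" by (auto simp: T_def I_def)
    ultimately have "card T \<le> card J" using fin by (rule card_inj_on_le)
    have "sum \<rho> T \<le> real (card T) * (20 ^ n / (50 * real (card J)))"
      using bound by (intro sum_bounded_above)
    also have "\<dots> \<le> real (card J) * (20 ^ n / (50 * real (card J)))"
      using \<open>card T \<le> card J\<close> by (intro mult_right_mono) auto
    also have "\<dots> = 20 ^ n / 50" using card1 by simp
    finally show ?thesis by (simp add: T_def)
  qed
  have \<rho>1: "1 \<le> \<rho> i" if "i \<in> I" for i
  proof -
    obtain j l where i: "i = (j, l)" by (cases i)
    then have "1 \<le> cmod (b j) ^ l"
      using that b1[of j] by (intro one_le_power) (auto simp: I_def)
    then show ?thesis by (simp add: i \<rho>_def)
  qed
  have close: "real_of_int \<bar>fst p - fst q\<bar> \<le> 2 * \<rho> i \<and> real_of_int \<bar>snd p - snd q\<bar> \<le> 2 * \<rho> i"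
    if "i \<in> I" "p \<in> Bad i" "q \<in> Bad i" "\<bar>fst p - fst q\<bar> \<le> 20 ^ lev i" "\<bar>snd p - snd q\<bar> \<le> 20 ^ lev i"
    for i p q
  proof -
    obtain j l where i: "i = (j, l)" by (cases i)
    with that have j: "j \<in> J" by (auto simp: I_def)
    have pq: "pt p - pt q = Complex (of_int (fst p - fst q)) (of_int (snd p - snd q))"
      by (simp add: pt_def case_prod_unfold complex_eq_iff)
    have "real_of_int \<bar>fst p - fst q\<bar> \<le> of_int (20 ^ lev i)" "real_of_int \<bar>snd p - snd q\<bar> \<le> of_int (20 ^ lev i)"
      using that(4,5) by (simp_all only: of_int_le_iff)
    then have "cmod (pt p - pt q) \<le> 2 * 20 ^ lev i"
      unfolding pq using cmod_le_abs_sum[of "of_int (fst p - fst q)" "of_int (snd p - snd q)"] by simp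
    also have "\<dots> \<le> cmod (b j) ^ Suc l / 2"
      using lv(1)[OF j, of l] zero_le_power[of "20::real" "lv j l"] unfolding i lev_def prod.case power_Suc[of 20] by linarith
    finally have "cmod (pt p - pt q) \<le> 6 * cmod (b j) ^ l"
      using near_lattice_points_close[OF b[OF j]] b6[OF j] that(2,3) unfolding i Bad_def by force
    then show ?thesis
      using abs_Re_le_cmod[of "pt p - pt q"] abs_Im_le_cmod[of "pt p - pt q"]
      unfolding pq by (simp add: i \<rho>_def)
  qed

  \<comment> \<open>The starting box and the point found in it\<close>
  have "1 \<le> X / 8" using X1000 by simp
  then obtain L where L: "20 ^ L \<le> X / 8" "X / 8 < 20 ^ Suc L"
    using greatest_power_le[of 20 "X / 8"] by auto
  \<comment> \<open>Every spacing is at most about \<open>X\<close>, and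
    \<open>X < 8 * 20 ^ Suc L\<close>; the factor 16 in the level thus puts all levels below
    \<open>L\<close>, and the initial potential is an empty sum.\<close>
  have inactive: "lev i < L" if "i \<in> I" for i
  proof -
    obtain j l where i: "i = (j, l)" by (cases i)
    with that have j: "j \<in> J" and l: "l < m j" by (auto simp: I_def)
    have "16 * 20 ^ Suc (lv j l) \<le> cmod (b j) ^ Suc l" by (rule lv(1)[OF j])
    also have "\<dots> \<le> cmod (b j) ^ m j" using b1[OF j] l by (intro power_increasing) auto
    also have "\<dots> < 16 * 20 ^ Suc L" using norm_bm(2)[OF j] L(2) X1000 by linarith
    finally have "(20::real) ^ Suc (lv j l) < 20 ^ Suc L" by simp
    then have "Suc (lv j l) < Suc L" by (rule power_less_imp_less_exp[rotated]) simp
    then show ?thesis by (simp add: i lev_def)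
  qed
  define x where "x = \<lfloor>X / 2\<rfloor>"
  have "{i \<in> I. L \<le> lev i \<and> Bad i \<inter> int_box L x x \<noteq> {}} = {}"
    using inactive by fastforce
  then have "(\<Sum>i | i \<in> I \<and> L \<le> lev i \<and> Bad i \<inter> int_box L x x \<noteq> {}. \<rho> i) \<le> 20 ^ L / 25"
    by (simp only: sum.empty) simp
  with finI \<rho>1 close new have "\<exists>p\<in>int_box L x x. \<forall>i\<in>I. p \<notin> Bad i"
    by (rule box_avoids_bad_sets)
  then obtain p where p: "p \<in> int_box L x x" "\<And>i. i \<in> I \<Longrightarrow> p \<notin> Bad i"
    by blast
  obtain u v where uv: "p = (u, v)" by (cases p)
  have near: "\<bar>real_of_int a - X / 2\<bar> \<le> X / 8" if "x \<le> a" "a < x + 20 ^ L" for a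
  proof -
    have "real_of_int a < of_int (x + 20 ^ L)" "real_of_int x \<le> of_int a"
      using that by (simp_all only: of_int_less_iff of_int_le_iff)
    then have "real_of_int a < of_int x + 20 ^ L" "real_of_int x \<le> of_int a" by simp_all
    moreover have "real_of_int x \<le> X / 2" "X / 2 < of_int x + 1"
      unfolding x_def by linarith+
    ultimately show ?thesis
      using L(1) X1000 by linarith
  qed
  have u: "\<bar>real_of_int u - X / 2\<bar> \<le> X / 8" and v: "\<bar>real_of_int v - X / 2\<bar> \<le> X / 8"
    using p(1) near unfolding uv int_box_def by auto
  \<comment> \<open>Both coordinates are off by at most \<open>X / 8\<close>, and sqrt(2)/8 <
    18/100. Replacing \<open>X\<close> by \<open>b j ^ m j\<close> costs another 1/100, and 19/100
    stays below a quarter of 99/100.\<close>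
  have centre: "cmod (pt p - Complex (1/2) (1/2) * of_real X) \<le> 18 / 100 * X"
  proof -
    have "(real_of_int u - X / 2)\<^sup>2 \<le> (X / 8)\<^sup>2" "(real_of_int v - X / 2)\<^sup>2 \<le> (X / 8)\<^sup>2"
      using u v X1000 by (simp_all add: abs_le_square_iff[symmetric])
    then have "(real_of_int u - X / 2)\<^sup>2 + (real_of_int v - X / 2)\<^sup>2 \<le> (18 / 100 * X)\<^sup>2"
      unfolding power_mult_distrib power_divide by simp (use zero_le_power2[of X] in linarith)
    moreover have "pt p - Complex (1/2) (1/2) * of_real X = Complex (of_int u - X / 2) (of_int v - X / 2)"
      by (simp add: pt_def uv complex_eq_iff)
    ultimately show ?thesis
      using X1000 by (simp only: complex_norm) (intro real_le_lsqrt, auto)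
  qed
  have "N < cmod (pt p)"
  proof -
    have "real_of_int u \<le> cmod (pt p)"
      using complex_Re_le_cmod[of "pt p"] by (simp add: pt_def uv)
    then show ?thesis using u XN X1000 by linarith
  qed
  moreover have "misses_zero_digit (b j) (pt p)" if j: "j \<in> J" for j
  proof (rule misses_zero_digitI[OF b[OF j] _ _ m_pos[OF j]])
    show "100 \<le> cmod (b j)" using b6[OF j] by simp
    show "pt p \<in> gauss_ints" by (simp add: pt_def uv gauss_ints_of_int)
    have "cmod (Complex (1/2) (1/2)) \<le> 1"
      using cmod_le_abs_sum[of "1/2" "1/2"] by simp
    then have "cmod (Complex (1/2) (1/2) * (b j ^ m j - of_real X)) \<le> 1 * (X / 100)"
      unfolding norm_mult using X[OF j] by (intro mult_mono) auto
    moreover have "pt p - Complex (1/2) (1/2) * b j ^ m j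
        = (pt p - Complex (1/2) (1/2) * of_real X) - Complex (1/2) (1/2) * (b j ^ m j - of_real X)"
      by (simp add: algebra_simps)
    ultimately have "cmod (pt p - Complex (1/2) (1/2) * b j ^ m j) \<le> 18 / 100 * X + X / 100"
      using centre norm_triangle_ineq4 by (smt (verit))
    then show "cmod (pt p - Complex (1/2) (1/2) * b j ^ m j) \<le> cmod (b j) ^ m j / 4"
      using norm_bm(1)[OF j] X1000 by linarith
    show "3 * cmod (b j) ^ l < cmod (pt p - b j ^ Suc l * w)" if "l < m j" "w \<in> gauss_ints" for l w
      using p(2)[of "(j, l)"] j that by (force simp: I_def Bad_def simp del: power_Suc)
  qed
  moreover have "pt p \<in> gauss_ints" by (simp add: pt_def uv gauss_ints_of_int)
  ultimately show ?thesis by blast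
qed

theorem theorem4p3:
  fixes k :: nat
  assumes "k \<ge> 2"
  shows "\<exists>M::real. M > 0 \<and>
    (\<forall>b :: nat \<Rightarrow> complex.
      (\<forall>j\<in>{1..k}. b j \<in> gauss_ints) \<longrightarrow> inj_on b {1..k} \<longrightarrow>
      (\<forall>j\<in>{1..k}. gnorm (b j) \<ge> M) \<longrightarrow>
      infinite {z \<in> gauss_ints. \<forall>j\<in>{1..k}. misses_zero_digit (b j) z})"
proof (intro exI[of _ "(10 ^ 6 * real k)\<^sup>2"] conjI allI impI)
  \<comment> \<open>The bound is a square because \<open>gnorm\<close> is the squared
    modulus.\<close>
  show "0 < (10 ^ 6 * real k)\<^sup>2" using assms by simp
next
  fix b :: "nat \<Rightarrow> complex"
  assume b: "\<forall>j\<in>{1..k}. b j \<in> gauss_ints" and M: "\<forall>j\<in>{1..k}. (10 ^ 6 * real k)\<^sup>2 \<le> gnorm (b j)"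
  have large: "10 ^ 6 * real (card {1..k}) \<le> cmod (b j)" if "j \<in> {1..k}" for j
    using M that unfolding gnorm_def by (auto intro: power2_le_imp_le)
  show "infinite {z \<in> gauss_ints. \<forall>j\<in>{1..k}. misses_zero_digit (b j) z}" (is "infinite ?Z")
  proof
    \<comment> \<open>A finite set is bounded, but solutions exist beyond every bound
      \<open>N\<close>.\<close>
    assume "finite ?Z"
    then obtain N where N: "\<forall>z\<in>?Z. cmod z \<le> N"
      using finite_imp_bounded bounded_iff by metis
    have "{1..k} \<noteq> {}" using assms by simp
    then obtain z where "z \<in> ?Z" "N < cmod z"
      using exists_large_misses_zero_digit[of "{1..k}" b N] b large by auto
    then show False using N by force
  qed
qed

end
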